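(* Let $A$ be a $\mathbb{P}$-matrix with finitely many nonzero entries, and let $\lambda=(\lambda_1,\lambda_2,\dots)$ be the common shape of the pair of tableaux $(S,U)$ corresponding to $A$ under the generalized RSK correspondence. Then $\ell(w_A)=\lambda_1$, where $w_A$ is the biword of $A$ and $\ell(w_A)$ is the length of the longest increasing subsequence in $w_A$.
   Context: Alphabet. $\mathbb{P}=\{1'<1<2'<2<3'<3<\cdots\}$ is a totally ordered alphabet; the symbols $k'$ are called marked and the symbols $k$ unmarked. Write $|k'|=|k|=k$ and $|0|=0$. A $\mathbb{P}$-matrix is a matrix $A=(a_{ij})_{i,j\ge1}$ with entries in $\mathbb{P}\cup\{0\}$ (a finite matrix is padded by zeros). Marked tableaux. A marked tableau of shape $\lambda$ is a filling of the Young diagram of the partition $\lambda$ by elements of $\mathbb{P}$ such that (T1) entries weakly increase along each row and down each column; (T2) for each $k\ge1$, each row contains at most one $k'$ and each column contains at most one $k$. A semi-standard tableau is a marked tableau with no marked entries. Biword. The biword $w_A$ of $A$ is the two-line array obtained by listing the pairs $\binom{i}{j}$ in lexicographic order of $(i,j)$, with $\binom{i}{j}$ repeated $|a_{ij}|$ times; if $a_{ij}$ is marked, then the lower entry $j$ of the first of these copies is replaced by $j'$. Write $w_A=\begin{pmatrix}\beta_1&\cdots&\beta_n\\ \alpha_1&\cdots&\alpha_n\end{pmatrix}$. Insertion. To insert $\alpha\in\mathbb{P}$ into a marked tableau $S$, start with $R$ the first row of $S$. If $\alpha$ is unmarked and is greater than or equal to every element of $R$, or $\alpha$ is marked and is greater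 than every element of $R$ (in particular if $R$ is empty), place $\alpha$ at the end of $R$ and stop. Otherwise: if $\alpha$ is unmarked, let $\beta$ be the smallest element of $R$ with $\beta>\alpha$; if $\alpha$ is marked, let $\beta$ be the smallest element of $R$ with $\beta\ge\alpha$; in both cases replace (the leftmost occurrence of) $\beta$ in $R$ by $\alpha$, then set $\alpha:=\beta$, let $R$ be the next row down, and repeat. The result, a marked tableau, is denoted $I_\alpha(S)$. Generalized RSK correspondence. Start with $(S_0,U_0)=(\emptyset,\emptyset)$. For $k=1,\dots,n$ let $S_k=I_{\alpha_k}(S_{k-1})$, and let $U_k$ be obtained from $U_{k-1}$ by writing $\beta_k$ in the new cell created by inserting $\alpha_k$ into $S_{k-1}$. Then $A$ corresponds to $(S,U)=(S_n,U_n)$, where $S$ is a marked tableau and $U$ is a semi-standard tableau of the same shape. Increasing subsequences. An increasing subsequence in $w_A$ is a weakly increasing subsequence of the lower line $\alpha_1,\dots,\alpha_n$ in which, for each positive integer $k$, the marked symbol $k'$ appears at most once. *)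

theory Defs
  imports Main "HOL-Library.Product_Lexorder" "HOL-Library.Sublist"
begin

text \<open>
  \<open>Marked k\<close> stands for k' and \<open>Unmarked k\<close> for k.  The type also contains the two junk
  symbols with k = 0; the alphabet proper is the set \<open>alphabet\<close> below.
\<close>

datatype psym = is_marked: Marked (absv: nat) | Unmarked (absv: nat)

definition alphabet :: "psym set" where
  "alphabet = {a. absv a \<ge> 1}"

instantiation psym :: linorder
begin

definition less_psym :: "psym \<Rightarrow> psym \<Rightarrow> bool" where
  "a < b \<longleftrightarrow> absv a < absv b \<or> (absv a = absv b \<and> is_marked a \<and> \<not> is_marked b)"

definition less_eq_psym :: "psym \<Rightarrow> psym \<Rightarrow> bool" where
  "a \<le> b \<longleftrightarrow> a < b \<or> a = (b :: psym)"

instance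
  by standard (auto simp: less_eq_psym_def less_psym_def intro: psym.expand)

end

lemma psym_order_chain:
  "Marked k < Unmarked k" "Unmarked k < Marked (Suc k)"
  by (simp_all add: less_psym_def)


text \<open>
  \<open>None\<close> is the entry 0.  Rows and columns are numbered from 1, so row 0 and column 0
  are required to be empty.
\<close>

type_synonym pmatrix = "nat \<Rightarrow> nat \<Rightarrow> psym option"

definition P_matrix :: "pmatrix \<Rightarrow> bool" where
  "P_matrix A \<longleftrightarrow> (\<forall>i j a. A i j = Some a \<longrightarrow> i \<ge> 1 \<and> j \<ge> 1 \<and> a \<in> alphabet)"

definition support :: "pmatrix \<Rightarrow> (nat \<times> nat) set" where
  "support A = {(i, j). A i j \<noteq> None}"


text \<open>
  A biword is the list of its columns, each written as a pair (upper entry, lower entry).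
  In \<open>biword\<close>, pairs of indices are compared lexicographically.
\<close>

type_synonym biword = "(nat \<times> psym) list"

definition entry_block :: "nat \<Rightarrow> nat \<Rightarrow> psym option \<Rightarrow> biword" where
  "entry_block i j e =
     (case e of
        None \<Rightarrow> []
      | Some a \<Rightarrow>
          let copies = replicate (absv a) (i, Unmarked j)
          in if is_marked a then copies[0 := (i, Marked j)] else copies)"

definition biword :: "pmatrix \<Rightarrow> biword" where
  "biword A = concat (map (\<lambda>(i, j). entry_block i j (A i j)) (sorted_list_of_set (support A)))"


text \<open>A tableau is the list of its rows, from top to bottom.\<close>

type_synonym 'a tableau = "'a list list"

definition shape :: "'a tableau \<Rightarrow> nat \<Rightarrow> nat" where
  "shape T i = (if 1 \<le> i \<and> i \<le> length T then length (T ! (i - 1)) else 0)"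


definition bumps :: "psym \<Rightarrow> psym \<Rightarrow> bool" where
  "bumps a b \<longleftrightarrow> (if is_marked a then a \<le> b else a < b)"

fun replace_first :: "'a \<Rightarrow> 'a \<Rightarrow> 'a list \<Rightarrow> 'a list" where
  "replace_first b a [] = []"
| "replace_first b a (x # xs) = (if x = b then a # xs else x # replace_first b a xs)"

text \<open>The second component of the result is the (0-based) index of the row of the new cell.\<close>

fun insert_at :: "psym \<Rightarrow> psym tableau \<Rightarrow> psym tableau \<times> nat" where
  "insert_at a [] = ([[a]], 0)"
| "insert_at a (R # S) =
     (if \<forall>x\<in>set R. \<not> bumps a x then ((R @ [a]) # S, 0)
      else let b = Min {x \<in> set R. bumps a x};
               (S', r) = insert_at b S
           in (replace_first b a R # S', Suc r))"

definition add_cell :: "nat \<Rightarrow> 'a \<Rightarrow> 'a tableau \<Rightarrow> 'a tableau" where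
  "add_cell r b U = (if r < length U then U[r := U ! r @ [b]] else U @ [[b]])"

definition rsk_step :: "nat \<times> psym \<Rightarrow> psym tableau \<times> nat tableau \<Rightarrow> psym tableau \<times> nat tableau"
  where
  "rsk_step = (\<lambda>(b, a) (S, U). let (S', r) = insert_at a S in (S', add_cell r b U))"

definition rsk :: "pmatrix \<Rightarrow> psym tableau \<times> nat tableau" where
  "rsk A = fold rsk_step (biword A) ([], [])"

lemma length_replace_first [simp]: "length (replace_first b a xs) = length xs"
  by (induction xs) auto

lemma insert_at_shape:
  "insert_at a S = (S', r) \<Longrightarrow> map length U = map length S \<Longrightarrow>
     map length S' = map length (add_cell r b U)"
proof (induction a S arbitrary: S' r U rule: insert_at.induct)
  case (1 a)
  then show ?case by (auto simp: add_cell_def)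
next
  case (2 a R S)
  from "2.prems"(2) obtain V Us where U: "U = V # Us" "length V = length R"
    "map length Us = map length S"
    by (cases U) auto
  show ?case
  proof (cases "\<forall>x\<in>set R. \<not> bumps a x")
    case True
    then show ?thesis using "2.prems"(1) U by (auto simp: add_cell_def)
  next
    case False
    define b' where "b' = Min {x \<in> set R. bumps a x}"
    obtain T s where T: "insert_at b' S = (T, s)" by fastforce
    have eq: "S' = replace_first b' a R # T" "r = Suc s"
      using "2.prems"(1) False T by (auto simp: b'_def Let_def)
    have "map length T = map length (add_cell s b Us)"
      using "2.IH"[OF False b'_def T U(3)] .
    then show ?thesis using eq U by (auto simp: add_cell_def)
  qed
qed

text \<open>Both tableaux always have the same shape.\<close>

lemma rsk_same_lengths:
  assumes "rsk A = (S, U)"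
  shows "map length S = map length U"
proof -
  have "map length S = map length U"
    if "fold rsk_step w (S0, U0) = (S, U)" "map length S0 = map length U0" for w S0 U0
    using that
  proof (induction w arbitrary: S0 U0)
    case Nil
    then show ?case by simp
  next
    case (Cons c w)
    obtain b a where c: "c = (b, a)" by (cases c)
    obtain T r where T: "insert_at a S0 = (T, r)" by fastforce
    have "map length T = map length (add_cell r b U0)"
      using insert_at_shape[OF T] Cons.prems(2) by metis
    then show ?case using Cons.IH Cons.prems(1) T c by (simp add: rsk_step_def)
  qed
  from this[of "biword A" "[]" "[]"] show ?thesis using assms by (simp add: rsk_def)
qed

lemma rsk_same_shape:
  assumes "rsk A = (S, U)"
  shows "shape S = shape U"
proof
  fix i
  have eq: "map length S = map length U" by (rule rsk_same_lengths[OF assms])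
  then have len: "length S = length U" using map_eq_imp_length_eq by blast
  show "shape S i = shape U i"
  proof (cases "1 \<le> i \<and> i \<le> length S")
    case True
    then have "i - 1 < length S" by linarith
    then have "length (S ! (i - 1)) = length (U ! (i - 1))"
      using eq len by (metis nth_map)
    then show ?thesis using len by (simp add: shape_def)
  next
    case False
    then show ?thesis using len by (auto simp: shape_def)
  qed
qed


definition increasing_subseq :: "psym list \<Rightarrow> biword \<Rightarrow> bool" where
  "increasing_subseq s w \<longleftrightarrow>
     subseq s (map snd w) \<and> sorted s \<and> (\<forall>k\<ge>1. count_list s (Marked k) \<le> 1)"

definition longest_increasing :: "biword \<Rightarrow> nat" where
  "longest_increasing w = Max {length s |s. increasing_subseq s w}"

text \<open>The maximum is taken over a finite nonempty set.\<close>

lemma increasing_subseq_lengths: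
  "finite {length s |s. increasing_subseq s w}" "{length s |s. increasing_subseq s w} \<noteq> {}"
proof -
  have "{length s |s. increasing_subseq s w} \<subseteq> {..length w}"
    by (auto simp: increasing_subseq_def dest: list_emb_length)
  then show "finite {length s |s. increasing_subseq s w}"
    using finite_subset by blast
  have "increasing_subseq [] w" by (simp add: increasing_subseq_def)
  then show "{length s |s. increasing_subseq s w} \<noteq> {}" by blast
qed

end

theory Submission
  imports Defs
begin

text \<open>
  Only the first row matters, and it evolves as in patience sorting.  Its entry in column i is
  always the smallest possible last letter of an increasing subsequence of length i in the
  part of the word read so far, so its length is the length of a longest such subsequence.
\<close>

text \<open>One relation governs both the rows of a marked tableau and increasing subsequences.\<close>

abbreviation may_follow :: "psym \<Rightarrow> psym \<Rightarrow> bool" where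
  "may_follow x y \<equiv> \<not> bumps y x"

abbreviation chain :: "psym list \<Rightarrow> bool" where
  "chain \<equiv> sorted_wrt may_follow"

lemma may_follow_iff: "may_follow x y \<longleftrightarrow> x \<le> y \<and> (x = y \<longrightarrow> \<not> is_marked x)"
  by (auto simp: bumps_def)

text \<open>If \<open>x = z\<close>, then \<open>y\<close> is squeezed to the same letter, which
  \<open>may_follow y z\<close> forces to be unmarked. This mixed transitivity lets last letters of
  subsequences be compared by \<open>\<le>\<close> alone.\<close>

lemma le_may_follow_trans: "x \<le> y \<Longrightarrow> may_follow y z \<Longrightarrow> may_follow x z"
  by (auto simp: may_follow_iff)

lemma may_follow_imp_le: "may_follow x y \<Longrightarrow> x \<le> y"
  by (simp add: may_follow_iff)

lemma bumps_imp_le: "bumps x y \<Longrightarrow> x \<le> y"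
  by (auto simp: bumps_def split: if_splits)

text \<open>Within a sorted list, \<open>chain\<close> only adds that no marked letter repeats. The
  counts on the right skip \<open>Marked 0\<close>, hence the restriction to
  \<open>alphabet\<close>.\<close>

lemma chain_iff_sorted:
  assumes "set s \<subseteq> alphabet"
  shows "chain s \<longleftrightarrow> sorted s \<and> (\<forall>k\<ge>1. count_list s (Marked k) \<le> 1)"
  using assms
proof (induction s)
  case Nil
  then show ?case by simp
next
  case (Cons x s)
  \<comment> \<open>A new head changes only its own count, so a marked head must be absent from the
    tail.\<close>
  have "(\<forall>k\<ge>1. count_list (x # s) (Marked k) \<le> 1) \<longleftrightarrow>
      (\<forall>k\<ge>1. count_list s (Marked k) \<le> 1) \<and> (is_marked x \<longrightarrow> x \<notin> set s)"
  proof (cases x)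
    case (Marked k)
    then have "1 \<le> k" using Cons.prems by (simp add: alphabet_def)
    then have "(\<forall>j\<ge>1. count_list (x # s) (Marked j) \<le> 1) \<longleftrightarrow>
        (\<forall>j\<ge>1. count_list s (Marked j) \<le> 1) \<and> count_list s (Marked k) = 0"
      using Marked by (simp only: count_list.simps psym.inject) force
    then show ?thesis using Marked by (simp add: count_list_0_iff)
  qed simp
  then show ?case
    using Cons by (auto simp: may_follow_iff)
qed

section \<open>Insertion into a single row\<close>

fun row_insert :: "psym \<Rightarrow> psym list \<Rightarrow> psym list" where
  "row_insert a [] = [a]"
| "row_insert a (x # xs) = (if bumps a x then a # xs else x # row_insert a xs)"

lemma row_insert_append:
  "\<forall>x\<in>set R. \<not> bumps a x \<Longrightarrow> row_insert a R = R @ [a]"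
  by (induction R) auto

text \<open>In a sorted row the leftmost bumped letter is also the smallest one, so a scan from the
  left finds the minimum.\<close>

lemma row_insert_replace_first:
  assumes "sorted R" "\<exists>x\<in>set R. bumps a x"
  shows "row_insert a R = replace_first (Min {x \<in> set R. bumps a x}) a R"
  using assms
proof (induction R)
  case Nil
  then show ?case by simp
next
  case (Cons x R)
  show ?case
  proof (cases "bumps a x")
    case True
    have "Min {y \<in> set (x # R). bumps a y} = x"
      by (rule Min_eqI) (use True Cons.prems in auto)
    then show ?thesis using True by simp
  next
    case False
    let ?B = "{y \<in> set R. bumps a y}"
    have eq: "{y \<in> set (x # R). bumps a y} = ?B" using False by auto
    have "Min ?B \<in> ?B" using Cons.prems False by (intro Min_in) auto
    then have "Min ?B \<noteq> x" using False by auto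
    then show ?thesis using Cons False by (simp only: eq row_insert.simps replace_first.simps) auto
  qed
qed

text \<open>Here \<open>p\<close> is the 0-based position where \<open>a\<close> lands. The case
  \<open>p = length R\<close> means that \<open>a\<close> is appended, which accounts for the
  \<open>max\<close>.\<close>

lemma row_insert_cases:
  obtains p where "p \<le> length R" "\<And>i. i < p \<Longrightarrow> may_follow (R ! i) a"
    "p < length R \<Longrightarrow> bumps a (R ! p)" "length (row_insert a R) = max (length R) (Suc p)"
    "\<And>i. i < length (row_insert a R) \<Longrightarrow> row_insert a R ! i = (if i = p then a else R ! i)"
proof -
  have "\<exists>p\<le>length R. (\<forall>i<p. may_follow (R ! i) a) \<and> (p < length R \<longrightarrow> bumps a (R ! p)) \<and>
    length (row_insert a R) = max (length R) (Suc p) \<and>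
    (\<forall>i<length (row_insert a R). row_insert a R ! i = (if i = p then a else R ! i))"
  proof (induction R)
    case Nil
    then show ?case by auto
  next
    case (Cons x R)
    show ?case
    proof (cases "bumps a x")
      case True
      then show ?thesis by (intro exI[of _ 0]) (auto simp: nth_Cons')
    next
      case False
      from Cons.IH obtain p where "p \<le> length R" "\<forall>i<p. may_follow (R ! i) a"
        "p < length R \<longrightarrow> bumps a (R ! p)" "length (row_insert a R) = max (length R) (Suc p)"
        "\<forall>i<length (row_insert a R). row_insert a R ! i = (if i = p then a else R ! i)"
        by blast
      then show ?thesis using False
        by (intro exI[of _ "Suc p"]) (simp add: All_less_Suc2)
    qed
  qed
  then show ?thesis using that by blast
qed

text \<open>Everything left of \<open>p\<close> may precede \<open>a\<close> by the choice of
  \<open>p\<close>. On the right, \<open>a\<close> replaces a letter that is at least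
  \<open>a\<close>.\<close>

lemma chain_row_insert:
  assumes "chain R"
  shows "chain (row_insert a R)"
proof -
  obtain p where p: "p \<le> length R" "\<And>i. i < p \<Longrightarrow> may_follow (R ! i) a"
    "p < length R \<Longrightarrow> bumps a (R ! p)" "length (row_insert a R) = max (length R) (Suc p)"
    "\<And>i. i < length (row_insert a R) \<Longrightarrow> row_insert a R ! i = (if i = p then a else R ! i)"
    by (rule row_insert_cases[of R a]) blast
  have R: "may_follow (R ! i) (R ! j)" if "i < j" "j < length R" for i j
    using assms that by (simp add: sorted_wrt_iff_nth_less)
  show ?thesis
    unfolding sorted_wrt_iff_nth_less
  proof (intro allI impI)
    fix i j assume ij: "i < j" "j < length (row_insert a R)"
    consider "i = p" | "j = p" | "i \<noteq> p" "j \<noteq> p" by blast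
    then show "may_follow (row_insert a R ! i) (row_insert a R ! j)"
    proof cases
      case 1
      then have j: "j < length R" using p(4) ij by auto
      then have "may_follow (R ! p) (R ! j)" "bumps a (R ! p)" using 1 ij R p(3) by auto
      then have "may_follow a (R ! j)" using bumps_imp_le le_may_follow_trans by blast
      then show ?thesis using 1 ij p(5) by simp
    next
      case 2
      then show ?thesis using ij p(2)[of i] p(5)[of i] p(5)[of j] by simp
    next
      case 3
      then have "j < length R" using p(1,4) ij by auto
      then show ?thesis using 3 ij R[of i j] p(5)[of i] p(5)[of j] by simp
    qed
  qed
qed

section \<open>The patience sorting invariant\<close>

definition tracks :: "psym list \<Rightarrow> psym list \<Rightarrow> bool" where
  "tracks w R \<longleftrightarrow> chain R \<and>
     (\<forall>i<length R. \<exists>s. subseq s w \<and> chain s \<and> length s = Suc i \<and> last s = R ! i) \<and>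
     (\<forall>s. subseq s w \<longrightarrow> chain s \<longrightarrow> s \<noteq> [] \<longrightarrow>
        length s \<le> length R \<and> R ! (length s - 1) \<le> last s)"

lemma subseq_snocE:
  assumes "subseq s (w @ [a])"
  obtains "subseq s w" | t where "s = t @ [a]" "subseq t w"
proof -
  obtain u v where uv: "s = u @ v" "subseq u w" "subseq v [a]"
    using assms by (auto simp: subseq_append_iff)
  from uv(3) have "v = [] \<or> v = [a]"
    by (cases v) (auto split: if_splits)
  then show ?thesis using uv that by auto
qed

text \<open>Earlier letters are at most the last one, so mixed transitivity reduces the check to the
  last letter.\<close>

lemma chain_snoc:
  assumes "chain s" "s \<noteq> [] \<Longrightarrow> may_follow (last s) a"
  shows "chain (s @ [a])"
  using assms
proof (cases s rule: rev_cases)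
  case (snoc t l)
  then have "may_follow l a" "\<forall>x\<in>set t. may_follow x l"
    using assms by (simp_all add: sorted_wrt_append)
  then have "\<forall>x\<in>set t. may_follow x a"
    using le_may_follow_trans may_follow_imp_le by blast
  then show ?thesis
    using snoc assms \<open>may_follow l a\<close> by (simp add: sorted_wrt_append)
qed simp

text \<open>Only position \<open>p\<close> changes: \<open>a\<close> extends a chain of length
  \<open>p\<close>, and no longer chain of \<open>w\<close> can be followed by
  \<open>a\<close>.\<close>

lemma tracks_row_insert:
  assumes "tracks w R"
  shows "tracks (w @ [a]) (row_insert a R)"
proof -
  let ?R = "row_insert a R"
  obtain p where p: "p \<le> length R" "\<And>i. i < p \<Longrightarrow> may_follow (R ! i) a"
    "p < length R \<Longrightarrow> bumps a (R ! p)" "length ?R = max (length R) (Suc p)"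
    "\<And>i. i < length ?R \<Longrightarrow> ?R ! i = (if i = p then a else R ! i)"
    by (rule row_insert_cases[of R a]) blast
  have R: "chain R"
    and ex: "\<And>i. i < length R \<Longrightarrow>
      \<exists>s. subseq s w \<and> chain s \<and> length s = Suc i \<and> last s = R ! i"
    and bound: "\<And>s. subseq s w \<Longrightarrow> chain s \<Longrightarrow> s \<noteq> [] \<Longrightarrow>
      length s \<le> length R \<and> R ! (length s - 1) \<le> last s"
    using assms by (auto simp: tracks_def)
  have "\<exists>s. subseq s (w @ [a]) \<and> chain s \<and> length s = Suc i \<and> last s = ?R ! i"
    if i: "i < length ?R" for i
  proof (cases "i = p")
    case False
    then have "i < length R" using i p(1,4) by auto
    then show ?thesis using ex[of i] False i p(5) by auto
  next
    case True
    \<comment> \<open>For \<open>p > 0\<close>, take the chain that witnesses entry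
      \<open>p - 1\<close>; its last letter is \<open>R ! (p - 1)\<close>, which \<open>a\<close>
      may follow.\<close>
    have "\<exists>t. subseq t w \<and> chain t \<and> length t = p \<and> (t \<noteq> [] \<longrightarrow> may_follow (last t) a)"
    proof (cases p)
      case 0
      then show ?thesis by (intro exI[of _ "[]"]) simp
    next
      case (Suc q)
      then show ?thesis using ex[of q] p(1,2) by fastforce
    qed
    then obtain t where t: "subseq t w" "chain t" "length t = p"
      "t \<noteq> [] \<Longrightarrow> may_follow (last t) a" by blast
    then have "chain (t @ [a])" using chain_snoc by blast
    then show ?thesis using t True i p(5) by (intro exI[of _ "t @ [a]"]) auto
  qed
  moreover have "length s \<le> length ?R \<and> ?R ! (length s - 1) \<le> last s"
    if s: "subseq s (w @ [a])" "chain s" "s \<noteq> []" for s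
    using s(1)
  proof (cases rule: subseq_snocE)
    case 1
    then have b: "length s \<le> length R" "R ! (length s - 1) \<le> last s"
      using bound s by auto
    then have l: "length s - 1 < length R" using s(3) by (cases s) auto
    \<comment> \<open>Insertion never increases an existing entry, so the old lower bound on
      \<open>last s\<close> survives.\<close>
    have "?R ! (length s - 1) \<le> R ! (length s - 1)"
      using l p(3-5) bumps_imp_le by auto
    then show ?thesis using b p(4) by auto
  next
    case (2 t)
    have t: "chain t" "t \<noteq> [] \<Longrightarrow> may_follow (last t) a"
      using s(2) 2 by (auto simp: sorted_wrt_append)
    \<comment> \<open>If \<open>t\<close> were longer than \<open>p\<close>, then
      \<open>R ! p\<close> would be at most \<open>last t\<close>. So \<open>a\<close> could follow
      \<open>R ! p\<close>, although it bumps that letter.\<close>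
    have tp: "length t \<le> p"
    proof (rule ccontr)
      assume "\<not> length t \<le> p"
      then have lt: "p < length t" by simp
      then have b: "length t \<le> length R" "R ! (length t - 1) \<le> last t" "t \<noteq> []"
        using bound[OF 2(2) t(1)] by fastforce+
      have "R ! p \<le> R ! (length t - 1)"
      proof (cases "p = length t - 1")
        case False
        then show ?thesis
          using R lt b(1) by (intro may_follow_imp_le) (auto simp: sorted_wrt_iff_nth_less)
      qed simp
      then have "may_follow (R ! p) a"
        using b t(2) le_may_follow_trans order_trans by blast
      then show False using p(3) lt b(1) by auto
    qed
    \<comment> \<open>The index \<open>length t\<close> is \<open>length s - 1\<close>. At
      \<open>p\<close> the entry is \<open>a\<close> itself; before \<open>p\<close> it is an old
      letter that \<open>a\<close> may follow.\<close>
    then have "?R ! length t \<le> a"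
      using p(2,4,5) may_follow_imp_le by auto
    then show ?thesis using tp p(4) 2 by auto
  qed
  ultimately show ?thesis using chain_row_insert[OF R] by (auto simp: tracks_def)
qed

section \<open>From tableau insertion to the first row\<close>

definition first_row :: "psym tableau \<Rightarrow> psym list" where
  "first_row S = (case S of [] \<Rightarrow> [] | R # _ \<Rightarrow> R)"

lemma shape_1: "shape S 1 = length (first_row S)"
  by (cases S) (auto simp: shape_def first_row_def)

text \<open>The bumped letter only enters lower rows. The chain hypothesis makes the row sorted, so
  that \<open>Min\<close> picks the letter \<open>row_insert\<close> replaces.\<close>

lemma first_row_insert_at:
  assumes "chain (first_row S)"
  shows "first_row (fst (insert_at a S)) = row_insert a (first_row S)"
proof (cases S)
  case Nil
  then show ?thesis by (simp add: first_row_def)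
next
  case (Cons R T)
  then have "chain R" using assms by (simp add: first_row_def)
  then have "sorted R" using may_follow_imp_le by (metis sorted_wrt_mono_rel)
  then show ?thesis
    using Cons row_insert_append[of R a] row_insert_replace_first[of R a]
    by (auto simp: first_row_def Let_def split: prod.split)
qed

text \<open>The invariant for the prefix also supplies the chain condition needed to describe the
  next insertion.\<close>

lemma tracks_rsk:
  "tracks (map snd w) (first_row (fst (fold rsk_step w ([], []))))"
proof (induction w rule: rev_induct)
  case Nil
  then show ?case by (auto simp: tracks_def first_row_def)
next
  case (snoc c w)
  let ?P = "fold rsk_step w ([], [])"
  have "fst (rsk_step c ?P) = fst (insert_at (snd c) (fst ?P))"
    by (simp add: rsk_step_def split: prod.split)
  moreover have "chain (first_row (fst ?P))" using snoc by (simp add: tracks_def)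
  ultimately show ?case using tracks_row_insert[OF snoc] by (simp add: first_row_insert_at)
qed

section \<open>Letters of the biword and the conclusion\<close>

lemma entry_block_alphabet:
  assumes "1 \<le> j"
  shows "snd ` set (entry_block i j e) \<subseteq> alphabet"
proof (cases e)
  case None
  then show ?thesis by (simp add: entry_block_def)
next
  case (Some a)
  have "set (entry_block i j e) \<subseteq> {(i, Marked j), (i, Unmarked j)}"
    using Some set_update_subset_insert[of "replicate (absv a) (i, Unmarked j)" 0 "(i, Marked j)"]
    by (auto simp: entry_block_def Let_def split: if_splits)
  then show ?thesis using assms by (auto simp: alphabet_def)
qed

text \<open>Nonzero entries lie in columns numbered from 1, so no junk symbol occurs and
  \<open>chain\<close> agrees with the official notion of increasing.\<close>

lemma biword_alphabet:
  assumes "P_matrix A" "finite (support A)"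
  shows "snd ` set (biword A) \<subseteq> alphabet"
proof -
  have "snd ` set (entry_block i j (A i j)) \<subseteq> alphabet" if "(i, j) \<in> support A" for i j
    using that assms(1) by (intro entry_block_alphabet) (auto simp: support_def P_matrix_def)
  then show ?thesis using assms(2) unfolding biword_def by fastforce
qed

lemma longest_increasing_eq_length_if_tracks:
  assumes "tracks (map snd w) R" "snd ` set w \<subseteq> alphabet"
  shows "longest_increasing w = length R"
proof -
  have iff: "increasing_subseq s w \<longleftrightarrow> subseq s (map snd w) \<and> chain s" for s
  proof (cases "subseq s (map snd w)")
    case True
    then have "set s \<subseteq> alphabet" using assms(2) by (fastforce elim: list_emb_set)
    then show ?thesis using True chain_iff_sorted by (simp add: increasing_subseq_def)
  qed (simp add: increasing_subseq_def)
  have "\<exists>s. increasing_subseq s w \<and> length s = length R"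
  proof (cases "length R")
    case 0
    then show ?thesis by (intro exI[of _ "[]"]) (simp add: iff)
  next
    case (Suc n)
    \<comment> \<open>The witness for the last entry \<open>R ! n\<close> is a chain of length
      \<open>Suc n\<close>, the full length of \<open>R\<close>.\<close>
    then show ?thesis using assms(1) unfolding tracks_def iff by (metis lessI)
  qed
  moreover have "length s \<le> length R" if "increasing_subseq s w" for s
    using that assms(1) unfolding tracks_def iff by (cases "s = []") auto
  ultimately show ?thesis
    unfolding longest_increasing_def
    by (intro Max_eqI increasing_subseq_lengths) (auto, metis)
qed

theorem theorem3:
  fixes A :: pmatrix
    and S :: "psym tableau"
    and U :: "nat tableau"
    and lam :: "nat \<Rightarrow> nat"
  assumes "P_matrix A"
    and "finite (support A)"
    and "rsk A = (S, U)"
    and "shape S = lam"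
    and "shape U = lam"
  shows "longest_increasing (biword A) = lam 1"
proof -
  have "tracks (map snd (biword A)) (first_row S)"
    using tracks_rsk[of "biword A"] assms(3) by (simp add: rsk_def)
  then show ?thesis
    using longest_increasing_eq_length_if_tracks biword_alphabet assms(1,2,4) shape_1 by metis
qed

end
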